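(* Let $V$ be a complex vector space with $\dim V=k$, and let $n$ be a positive integer with $k^2<n$. Let $S_n$ act on $V^{\otimes n}$ by permuting tensor factors (no signs), giving the algebra homomorphism $\varphi:\mathbb{C}S_n\to \mathrm{End}_{\mathbb{C}}(V^{\otimes n})$, $\varphi_\sigma(v_1\otimes\cdots\otimes v_n)=v_{\sigma^{-1}(1)}\otimes\cdots\otimes v_{\sigma^{-1}(n)}$. Let $A_n\subseteq S_n$ be the alternating group. Then $$\varphi(\mathbb{C}A_n)=\varphi(\mathbb{C}S_n),\qquad\text{and hence}\qquad \mathrm{End}_{\mathbb{C}A_n}(V^{\otimes n})=\mathrm{End}_{\mathbb{C}S_n}(V^{\otimes n}),$$ where $\mathrm{End}_{\mathbb{C}G}(V^{\otimes n})$ denotes the algebra of linear maps $V^{\otimes n}\to V^{\otimes n}$ commuting with $\varphi_\sigma$ for all $\sigma\in G$. *)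

theory Defs
  imports Complex_Main "HOL-Library.Cardinality" "HOL-Library.Poly_Mapping"
    "HOL-Combinatorics.Permutations"
begin

class scaleC =
  fixes scaleC :: "complex \<Rightarrow> 'a \<Rightarrow> 'a" (infixr \<open>*\<^sub>C\<close> 75)

class complex_vector = scaleC + ab_group_add +
  assumes scaleC_add_right: "c *\<^sub>C (x + y) = c *\<^sub>C x + c *\<^sub>C y"
    and scaleC_add_left: "(c + d) *\<^sub>C x = c *\<^sub>C x + d *\<^sub>C x"
    and scaleC_scaleC: "c *\<^sub>C (d *\<^sub>C x) = (c * d) *\<^sub>C x"
    and scaleC_one: "1 *\<^sub>C x = x"

global_interpretation complex_vector: vector_space "scaleC :: complex \<Rightarrow> 'a \<Rightarrow> 'a :: complex_vector"
  by unfold_locales (simp_all add: scaleC_add_right scaleC_add_left scaleC_scaleC scaleC_one)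

abbreviation clinear :: "('a::complex_vector \<Rightarrow> 'b::complex_vector) \<Rightarrow> bool"
  where "clinear \<equiv> Vector_Spaces.linear (*\<^sub>C) (*\<^sub>C)"

lemma clinearI:
  assumes "\<And>x y. f (x + y) = f x + f y" "\<And>c x. f (c *\<^sub>C x) = c *\<^sub>C f x"
  shows "clinear f"
  using assms by unfold_locales

instantiation complex :: complex_vector
begin
definition scaleC_complex :: "complex \<Rightarrow> complex \<Rightarrow> complex"
  where "scaleC_complex = (*)"
instance by standard (simp_all add: scaleC_complex_def algebra_simps)
end

instantiation poly_mapping :: (type, complex_vector) complex_vector
begin
lift_definition scaleC_poly_mapping :: "complex \<Rightarrow> ('a \<Rightarrow>\<^sub>0 'b) \<Rightarrow> ('a \<Rightarrow>\<^sub>0 'b)"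
  is "\<lambda>c f x. c *\<^sub>C f x"
  by (erule rev_finite_subset) auto
instance
  by standard (transfer, simp add: fun_eq_iff scaleC_add_right scaleC_add_left scaleC_scaleC scaleC_one)+
end

(* ('v, 'n) tensor_power is the tensor product of CARD('n) copies of 'v, with factors labelled by
   'n: the free complex vector space on the tuples 'n => 'v modulo multilinearity in each entry. *)

definition multilinear_relators :: "(('n \<Rightarrow> 'v::complex_vector) \<Rightarrow>\<^sub>0 complex) set" where
  "multilinear_relators =
     {Poly_Mapping.single (v(i := x + y)) 1
        - (Poly_Mapping.single (v(i := x)) 1 + Poly_Mapping.single (v(i := y)) 1) | v i x y. True}
   \<union> {Poly_Mapping.single (v(i := c *\<^sub>C x)) 1
        - c *\<^sub>C Poly_Mapping.single (v(i := x)) 1 | v i c x. True}"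

definition tensor_rel ::
    "(('n \<Rightarrow> 'v::complex_vector) \<Rightarrow>\<^sub>0 complex) \<Rightarrow> (('n \<Rightarrow> 'v) \<Rightarrow>\<^sub>0 complex) \<Rightarrow> bool"
  where "tensor_rel p q \<longleftrightarrow> p - q \<in> complex_vector.span multilinear_relators"

lemma equivp_tensor_rel:
  "equivp (tensor_rel :: (('n \<Rightarrow> 'v::complex_vector) \<Rightarrow>\<^sub>0 complex) \<Rightarrow> _)"
  (is "equivp ?R")
proof (rule equivpI)
  show "reflp ?R"
    by (rule reflpI) (simp add: tensor_rel_def complex_vector.span_zero)
  show "symp ?R"
  proof (rule sympI)
    fix p q :: "('n \<Rightarrow> 'v) \<Rightarrow>\<^sub>0 complex"
    assume "tensor_rel p q"
    from complex_vector.span_neg[OF this[unfolded tensor_rel_def]]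
    show "tensor_rel q p" by (simp add: tensor_rel_def)
  qed
  show "transp ?R"
  proof (rule transpI)
    fix p q r :: "('n \<Rightarrow> 'v) \<Rightarrow>\<^sub>0 complex"
    assume "tensor_rel p q" "tensor_rel q r"
    from complex_vector.span_add[OF this[unfolded tensor_rel_def]]
    show "tensor_rel p r" by (simp add: tensor_rel_def)
  qed
qed

quotient_type (overloaded) ('v, 'n) tensor_power =
  "('n::finite \<Rightarrow> 'v::complex_vector) \<Rightarrow>\<^sub>0 complex" / tensor_rel
  by (rule equivp_tensor_rel)

instantiation tensor_power :: (complex_vector, finite) complex_vector
begin

lift_definition zero_tensor_power :: "('a, 'b) tensor_power" is 0 .

lift_definition plus_tensor_power ::
    "('a, 'b) tensor_power \<Rightarrow> ('a, 'b) tensor_power \<Rightarrow> ('a, 'b) tensor_power" is "(+)"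
proof -
  fix p p' q q' :: "('b \<Rightarrow> 'a) \<Rightarrow>\<^sub>0 complex"
  assume "tensor_rel p p'" "tensor_rel q q'"
  from complex_vector.span_add[OF this[unfolded tensor_rel_def]]
  show "tensor_rel (p + q) (p' + q')" by (simp add: tensor_rel_def add_diff_add)
qed

lift_definition uminus_tensor_power ::
    "('a, 'b) tensor_power \<Rightarrow> ('a, 'b) tensor_power" is uminus
proof -
  fix p p' :: "('b \<Rightarrow> 'a) \<Rightarrow>\<^sub>0 complex"
  assume "tensor_rel p p'"
  from complex_vector.span_neg[OF this[unfolded tensor_rel_def]]
  show "tensor_rel (- p) (- p')" by (simp add: tensor_rel_def)
qed

lift_definition minus_tensor_power ::
    "('a, 'b) tensor_power \<Rightarrow> ('a, 'b) tensor_power \<Rightarrow> ('a, 'b) tensor_power" is "(-)"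
proof -
  fix p p' q q' :: "('b \<Rightarrow> 'a) \<Rightarrow>\<^sub>0 complex"
  assume "tensor_rel p p'" "tensor_rel q q'"
  from complex_vector.span_diff[OF this[unfolded tensor_rel_def]]
  show "tensor_rel (p - q) (p' - q')" by (simp add: tensor_rel_def algebra_simps)
qed

lift_definition scaleC_tensor_power ::
    "complex \<Rightarrow> ('a, 'b) tensor_power \<Rightarrow> ('a, 'b) tensor_power" is scaleC
proof -
  fix c and p p' :: "('b \<Rightarrow> 'a) \<Rightarrow>\<^sub>0 complex"
  assume "tensor_rel p p'"
  from complex_vector.span_scale[OF this[unfolded tensor_rel_def], of c]
  show "tensor_rel (c *\<^sub>C p) (c *\<^sub>C p')"
    by (simp add: tensor_rel_def complex_vector.scale_right_diff_distrib)
qed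

instance
  by standard
    (transfer, simp add: tensor_rel_def algebra_simps complex_vector.span_zero
       scaleC_add_right scaleC_add_left scaleC_scaleC scaleC_one)+

end

lift_definition pure_tensor :: "('n::finite \<Rightarrow> 'v::complex_vector) \<Rightarrow> ('v, 'n) tensor_power"
  is "\<lambda>v. Poly_Mapping.single v 1" .

lemma tensor_rel_imageI:
  fixes g :: "(('n \<Rightarrow> 'v::complex_vector) \<Rightarrow>\<^sub>0 complex) \<Rightarrow> 'w::complex_vector"
  assumes "clinear g" and "tensor_rel p q" and "\<And>r. r \<in> multilinear_relators \<Longrightarrow> g r \<in> complex_vector.span S"
  shows "g p - g q \<in> complex_vector.span S"
proof -
  interpret g: Vector_Spaces.linear "(*\<^sub>C)" "(*\<^sub>C)" g by fact
  have "g (p - q) \<in> complex_vector.span (g ` multilinear_relators)"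
    using assms(2) unfolding tensor_rel_def g.span_image by blast
  also have "\<dots> \<subseteq> complex_vector.span S"
    by (rule complex_vector.span_minimal) (use assms(3) in auto)
  finally show ?thesis by (simp add: g.diff)
qed

lemma clinear_eq_on_pure_tensors:
  fixes f g :: "('v::complex_vector, 'n::finite) tensor_power \<Rightarrow> 'w::complex_vector"
  assumes f: "clinear f" and g: "clinear g" and eq: "\<And>v. f (pure_tensor v) = g (pure_tensor v)"
  shows "f = g"
proof
  interpret f: Vector_Spaces.linear "(*\<^sub>C)" "(*\<^sub>C)" f by fact
  interpret g: Vector_Spaces.linear "(*\<^sub>C)" "(*\<^sub>C)" g by fact
  fix t
  have *: "f (abs_tensor_power p) = g (abs_tensor_power p)" for p
  proof (induction p rule: Poly_Mapping.update_induct)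
    case const
    then show ?case by (simp flip: zero_tensor_power_def)
  next
    case (update p v c)
    have "Poly_Mapping.update v c p = p + c *\<^sub>C Poly_Mapping.single v 1"
      using update(1) by (intro poly_mapping_eqI)
        (auto simp: lookup_update lookup_add scaleC_poly_mapping.rep_eq lookup_single
           scaleC_complex_def in_keys_iff when_def)
    hence "abs_tensor_power (Poly_Mapping.update v c p) =
             abs_tensor_power p + c *\<^sub>C pure_tensor v"
      by (simp add: plus_tensor_power.abs_eq scaleC_tensor_power.abs_eq pure_tensor.abs_eq)
    then show ?case
      by (simp add: f.add g.add f.scale g.scale update eq)
  qed
  show "f t = g t"
    by (induction t rule: tensor_power.abs_induct) (rule *)
qed

(* Position i of the image of a pure tensor carries the old entry at position inv \<sigma> i.  The
   description is only proper for permutations \<sigma>; see tensor_perm_exists and tensor_perm below. *)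
definition tensor_perm ::
    "('n \<Rightarrow> 'n) \<Rightarrow> ('v::complex_vector, 'n::finite) tensor_power \<Rightarrow> ('v, 'n) tensor_power"
  where "tensor_perm \<sigma> =
    (THE f. clinear f \<and> (\<forall>v. f (pure_tensor v) = pure_tensor (v \<circ> inv \<sigma>)))"

lemma tensor_perm_exists:
  fixes \<sigma> :: "'n::finite \<Rightarrow> 'n"
  assumes "\<sigma> permutes UNIV"
  shows "\<exists>f :: ('v::complex_vector, 'n) tensor_power \<Rightarrow> ('v, 'n) tensor_power.
           clinear f \<and> (\<forall>v. f (pure_tensor v) = pure_tensor (v \<circ> inv \<sigma>))"
proof -
  have bij: "bij \<sigma>" using assms by (rule permutes_bij)
  define h :: "('n \<Rightarrow> 'v) \<Rightarrow> 'n \<Rightarrow> 'v" where "h = (\<lambda>w. w \<circ> \<sigma>)"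
  have inj_h: "inj h"
    unfolding h_def by (rule injI) (metis bij bij_is_surj comp_assoc comp_id surj_iff)
  define g where "g = (Poly_Mapping.map_key h :: (('n \<Rightarrow> 'v) \<Rightarrow>\<^sub>0 complex) \<Rightarrow> _)"
  have g_single: "g (Poly_Mapping.single v c) = Poly_Mapping.single (v \<circ> inv \<sigma>) c" for v c
  proof -
    have "v = h (v \<circ> inv \<sigma>)"
      using bij by (simp add: h_def comp_assoc bij_is_inj)
    then show ?thesis unfolding g_def using inj_h by (metis map_key_single)
  qed
  have lin: "clinear g"
  proof (rule clinearI)
    show "g (p + q) = g p + g q" for p q
      unfolding g_def using inj_h by (rule map_key_plus)
    show "g (c *\<^sub>C p) = c *\<^sub>C g p" for c p
      unfolding g_def using inj_h
      by (intro poly_mapping_eqI) (simp add: map_key.rep_eq scaleC_poly_mapping.rep_eq)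
  qed
  interpret g: Vector_Spaces.linear "(*\<^sub>C)" "(*\<^sub>C)" g by fact
  have upd: "(v(i := x)) \<circ> inv \<sigma> = (v \<circ> inv \<sigma>)(\<sigma> i := x)" for v :: "'n \<Rightarrow> 'v" and i x
    using bij by (auto simp: fun_eq_iff bij_is_inj bij_is_surj surj_f_inv_f)
  have "g r \<in> multilinear_relators" if "r \<in> multilinear_relators" for r
    using that unfolding multilinear_relators_def
    by (elim UnE; elim CollectE exE conjE; simp add: g.add g.diff g.scale g_single upd; blast)
  hence rel: "tensor_rel (g p) (g q)" if "tensor_rel p q" for p q
    unfolding tensor_rel_def
    by (intro tensor_rel_imageI[OF lin that] complex_vector.span_base)
  define f where "f = map_fun rep_tensor_power abs_tensor_power g"
  have f_abs: "f (abs_tensor_power p) = abs_tensor_power (g p)" for p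
    unfolding f_def using rel
    by (simp add: tensor_power.abs_eq_iff Quotient3_tensor_power rep_abs_rsp_left[OF Quotient3_tensor_power] equivp_reflp[OF equivp_tensor_rel])
  have "clinear f"
  proof (rule clinearI)
    show "f (s + t) = f s + f t" for s t
      by (induction s rule: tensor_power.abs_induct, induction t rule: tensor_power.abs_induct)
        (simp add: plus_tensor_power.abs_eq f_abs g.add)
    show "f (c *\<^sub>C t) = c *\<^sub>C f t" for c t
      by (induction t rule: tensor_power.abs_induct)
        (simp add: scaleC_tensor_power.abs_eq f_abs g.scale)
  qed
  moreover have "f (pure_tensor v) = pure_tensor (v \<circ> inv \<sigma>)" for v
    by (simp add: pure_tensor.abs_eq f_abs g_single)
  ultimately show ?thesis by blast
qed

lemma tensor_perm:
  fixes \<sigma> :: "'n::finite \<Rightarrow> 'n"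
  assumes "\<sigma> permutes UNIV"
  shows clinear_tensor_perm: "clinear (tensor_perm \<sigma> :: ('v::complex_vector, 'n) tensor_power \<Rightarrow> _)"
    and tensor_perm_pure: "tensor_perm \<sigma> (pure_tensor v) = pure_tensor ((v :: 'n \<Rightarrow> 'v) \<circ> inv \<sigma>)"
proof -
  have "\<exists>!f :: ('v, 'n) tensor_power \<Rightarrow> ('v, 'n) tensor_power.
          clinear f \<and> (\<forall>v. f (pure_tensor v) = pure_tensor (v \<circ> inv \<sigma>))"
    by (rule ex_ex1I[OF tensor_perm_exists[OF assms]]) (auto intro: clinear_eq_on_pure_tensors)
  from theI'[OF this, folded tensor_perm_def]
  show "clinear (tensor_perm \<sigma> :: ('v, 'n) tensor_power \<Rightarrow> _)"
    and "tensor_perm \<sigma> (pure_tensor v) = pure_tensor ((v :: 'n \<Rightarrow> 'v) \<circ> inv \<sigma>)"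
    by blast+
qed

lemma tensor_perm_compose:
  fixes \<sigma> \<tau> :: "'n::finite \<Rightarrow> 'n"
  assumes "\<sigma> permutes UNIV" "\<tau> permutes UNIV"
  shows "(tensor_perm (\<sigma> \<circ> \<tau>) :: ('v::complex_vector, 'n) tensor_power \<Rightarrow> _)
           = tensor_perm \<sigma> \<circ> tensor_perm \<tau>"
proof (rule clinear_eq_on_pure_tensors)
  have "inv (\<sigma> \<circ> \<tau>) = inv \<tau> \<circ> inv \<sigma>"
    using assms by (intro o_inv_distrib permutes_bij)
  then show "tensor_perm (\<sigma> \<circ> \<tau>) (pure_tensor v) = (tensor_perm \<sigma> \<circ> tensor_perm \<tau>) (pure_tensor v)"
    for v :: "'n \<Rightarrow> 'v"
    using assms by (simp add: tensor_perm_pure permutes_compose comp_assoc)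
qed (use assms in \<open>auto intro!: clinear_tensor_perm permutes_compose Vector_Spaces.linear_compose\<close>)

definition symmetric_group :: "('n::finite \<Rightarrow> 'n) set"
  where "symmetric_group = {\<sigma>. \<sigma> permutes UNIV}"

definition alternating_group :: "('n::finite \<Rightarrow> 'n) set"
  where "alternating_group = {\<sigma>. \<sigma> permutes UNIV \<and> evenperm \<sigma>}"

(* Underlying vector space only: the instance multiplication on poly_mapping is not the convolution
   product of the group algebra and plays no role here. *)
definition group_algebra :: "('n \<Rightarrow> 'n) set \<Rightarrow> (('n \<Rightarrow> 'n) \<Rightarrow>\<^sub>0 complex) set"
  where "group_algebra G = {a. Poly_Mapping.keys a \<subseteq> G}"

definition tensor_rep ::
    "(('n \<Rightarrow> 'n) \<Rightarrow>\<^sub>0 complex) \<Rightarrow> ('v::complex_vector, 'n::finite) tensor_power \<Rightarrow> ('v, 'n) tensor_power"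
  where "tensor_rep a = (\<lambda>t. \<Sum>\<sigma>\<in>Poly_Mapping.keys a. Poly_Mapping.lookup a \<sigma> *\<^sub>C tensor_perm \<sigma> t)"

definition commuting_End ::
    "('n \<Rightarrow> 'n) set \<Rightarrow> (('v::complex_vector, 'n::finite) tensor_power \<Rightarrow> ('v, 'n) tensor_power) set"
  where "commuting_End G =
    {f. clinear f \<and> (\<forall>\<sigma>\<in>G. f \<circ> tensor_perm \<sigma> = tensor_perm \<sigma> \<circ> f)}"

end

theory Submission
  imports Defs "HOL-Analysis.Cartesian_Euclidean_Space"
begin

text \<open>
  Fix a basis \<open>B\<close> of \<open>V\<close>. For tuples \<open>P, Q\<close> of basis vectors, the matrix entries of the
  permutations give vectors \<open>coeff_vec P Q\<close> in \<open>\<real>\<^bsup>S\<^sub>n\<^esup>\<close>, namely \<open>coeff_vec P Q \<sigma> = 1\<close> if \<open>P \<circ> \<sigma> = Q\<close> and \<open>0\<close>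
  otherwise, and an element of the group algebra acts as zero if it is orthogonal to their span \<open>W\<close>.
  As \<open>n > k\<^sup>2\<close>, every pair of tuples \<open>(Q, R)\<close> takes the same value at two positions, and
  composing with their transposition is a sign-reversing involution which shows that \<open>sgn \<cdot> W\<close> is
  orthogonal to \<open>W\<close>. Given an odd \<open>\<tau>\<close>, write \<open>\<delta>\<^sub>\<tau> = w + z\<close> with \<open>w \<in> W\<close> and
  \<open>z\<close> orthogonal to \<open>W\<close>. Then \<open>z - sgn \<cdot> w\<close> acts as zero and agrees with \<open>\<delta>\<^sub>\<tau>\<close> at the odd permutations, so \<open>\<tau>\<close> acts as a
  combination of even permutations.
\<close>

section \<open>Multilinearity and vanishing of linear maps on tensor powers\<close>

lemma pure_tensor_add:
  "pure_tensor (v(i := x + y)) = pure_tensor (v(i := x)) + pure_tensor (v(i := y))"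
  by transfer (unfold tensor_rel_def multilinear_relators_def, rule complex_vector.span_base, blast)

lemma pure_tensor_scale:
  "pure_tensor (v(i := c *\<^sub>C x)) = c *\<^sub>C pure_tensor (v(i := x))"
  by transfer (unfold tensor_rel_def multilinear_relators_def, rule complex_vector.span_base, blast)

text \<open>A pure tensor is linear in each entry, so entries outside \<open>B\<close> can be
  handled one position at a time.\<close>

lemma clinear_eq_0_if_eq_0_on_spanning_tensors:
  fixes f :: "('v::complex_vector, 'n::finite) tensor_power \<Rightarrow> 'w::complex_vector"
  assumes f: "clinear f" and B: "complex_vector.span B = UNIV"
    and zero: "\<And>v. range v \<subseteq> B \<Longrightarrow> f (pure_tensor v) = 0"
  shows "f t = 0"
proof -
  interpret f: Vector_Spaces.linear "(*\<^sub>C)" "(*\<^sub>C)" f by fact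
  \<comment> \<open>\<open>S\<close> collects the positions with unrestricted entries;
    \<open>S = UNIV\<close> covers every pure tensor.\<close>
  have *: "f (pure_tensor v) = 0" if "v ` (- S) \<subseteq> B" for v S
    using finite[of S] that
  proof (induction S arbitrary: v rule: finite_induct)
    case empty
    then show ?case by (simp add: zero)
  next
    case (insert i S)
    have "f (pure_tensor (v(i := x))) = 0" if "x \<in> complex_vector.span B" for x
      using that
    proof (induction rule: complex_vector.span_induct_alt)
      case base
      \<comment> \<open>A zero entry is \<open>0\<close> times itself, so a pure tensor containing
        it is zero.\<close>
      show ?case using pure_tensor_scale[of v i 0 0] f.zero
        by (simp del: fun_upd_apply)
    next
      case (step c x y)
      have "f (pure_tensor (v(i := x))) = 0"
        by (rule insert.IH) (use step.hyps insert.prems in auto)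
      then show ?case
        using step.IH
        by (simp add: pure_tensor_add pure_tensor_scale f.add f.scale del: fun_upd_apply)
    qed
    from this[of "v i"] have "f (pure_tensor (v(i := v i))) = 0" by (simp add: B)
    then show ?case by simp
  qed
  have "f = (\<lambda>_. 0)"
    by (rule clinear_eq_on_pure_tensors[OF f]) (auto intro: clinearI *[of _ UNIV])
  then show ?thesis by simp
qed

section \<open>Orthogonality of matrix coefficients and their sign twists\<close>

text \<open>As a function of \<sigma>, this is the entry of \<open>tensor_perm \<sigma>\<close> at
  row \<open>P\<close> and column \<open>Q\<close> with respect to tuples of basis vectors:
  \<open>P \<circ> \<sigma> = Q\<close> says that \<open>Q \<circ> inv \<sigma> = P\<close>.
  Extension by zero to all self-maps of the index type gives vectors of a Euclidean space, where
  orthogonal decomposition is available.\<close>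

definition coeff_vec :: "('n \<Rightarrow> 'v) \<Rightarrow> ('n \<Rightarrow> 'v) \<Rightarrow> real ^ ('n::finite \<Rightarrow> 'n)"
  where "coeff_vec P Q = (\<chi> \<sigma>. if \<sigma> permutes UNIV \<and> P \<circ> \<sigma> = Q then 1 else 0)"

definition sign_twist :: "real ^ ('n::finite \<Rightarrow> 'n) \<Rightarrow> real ^ ('n \<Rightarrow> 'n)"
  where "sign_twist w = (\<chi> \<sigma>. of_int (sign \<sigma>) * w $ \<sigma>)"

lemma linear_sign_twist: "linear sign_twist"
  by (rule linearI) (simp_all add: sign_twist_def vec_eq_iff algebra_simps)

lemma inner_coeff_vec:
  "x \<bullet> coeff_vec P Q = (\<Sum>\<sigma> | \<sigma> permutes UNIV \<and> P \<circ> \<sigma> = Q. x $ \<sigma>)"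
  by (simp add: inner_vec_def coeff_vec_def sum.If_cases if_distrib cong: if_cong)

lemma inner_sign_twist_coeff_vec:
  fixes P Q R S :: "'n::finite \<Rightarrow> 'v"
  assumes B: "finite B" "(card B)\<^sup>2 < CARD('n)" and rng: "range Q \<subseteq> B" "range S \<subseteq> B"
  shows "sign_twist (coeff_vec P Q) \<bullet> coeff_vec R S = 0"
proof -
  let ?A = "{\<sigma>. \<sigma> permutes (UNIV :: 'n set) \<and> P \<circ> \<sigma> = Q \<and> R \<circ> \<sigma> = S}"
  \<comment> \<open>Pigeonhole: these pairs lie in \<open>B \<times> B\<close>, which has fewer than
    \<open>CARD('n)\<close> elements.\<close>
  have "\<not> inj (\<lambda>i. (Q i, S i))"
  proof
    assume "inj (\<lambda>i. (Q i, S i))"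
    then have "CARD('n) \<le> card (B \<times> B)"
      using B(1) rng by (intro card_inj_on_le) auto
    then show False
      using B(2) by (simp add: card_cartesian_product power2_eq_square)
  qed
  then obtain i j where ij: "i \<noteq> j" "Q i = Q j" "S i = S j"
    by (auto simp: inj_on_def)
  let ?t = "Transposition.transpose i j"
  have t: "?t permutes UNIV" by (simp add: permutes_swap_id)
  have inv: "f \<circ> ?t = f" if "f i = f j" for f :: "'n \<Rightarrow> 'v"
    using that by (auto simp: fun_eq_iff Transposition.transpose_def)
  have maps: "\<sigma> \<circ> ?t \<in> ?A" if "\<sigma> \<in> ?A" for \<sigma>
    using that t inv ij by (auto simp: permutes_compose simp flip: comp_assoc)
  have eq: "sign_twist (coeff_vec P Q) \<bullet> coeff_vec R S = (\<Sum>\<sigma>\<in>?A. real_of_int (sign \<sigma>))"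
    unfolding inner_coeff_vec
    by (rule sum.mono_neutral_cong_right) (auto simp: sign_twist_def coeff_vec_def)
  \<comment> \<open>Right multiplication by \<open>?t\<close> is an involution of \<open>?A\<close>,
    since \<open>Q\<close> and \<open>S\<close> each agree at the two swapped positions; it flips
    every sign.\<close>
  have "(\<Sum>\<sigma>\<in>?A. real_of_int (sign \<sigma>)) = (\<Sum>\<sigma>\<in>?A. real_of_int (sign (\<sigma> \<circ> ?t)))"
    by (rule sum.reindex_bij_witness[of _ "\<lambda>\<sigma>. \<sigma> \<circ> ?t" "\<lambda>\<sigma>. \<sigma> \<circ> ?t"])
      (use maps in \<open>auto simp: comp_assoc\<close>)
  also have "\<dots> = (\<Sum>\<sigma>\<in>?A. - real_of_int (sign \<sigma>))"
  proof (rule sum.cong)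
    fix \<sigma> assume "\<sigma> \<in> ?A"
    then have "permutation \<sigma>" using permutation_permutes by (metis (lifting) finite mem_Collect_eq)
    then show "real_of_int (sign (\<sigma> \<circ> ?t)) = - real_of_int (sign \<sigma>)"
      using ij by (simp add: sign_compose permutation_swap_id sign_swap_id)
  qed simp
  finally have "(\<Sum>\<sigma>\<in>?A. real_of_int (sign \<sigma>)) = 0"
    by (simp add: sum_negf)
  with eq show ?thesis by simp
qed

text \<open>For odd \<tau>, the entries of \<open>x\<close> will be the coefficients of a linear
  relation among the operators \<open>tensor_perm \<sigma>\<close> in which \<tau> is the only odd
  permutation.\<close>

lemma obtain_coeff_orthogonal_with_odd_part:
  fixes \<tau> :: "'n::finite \<Rightarrow> 'n"
  assumes B: "finite B" "(card B)\<^sup>2 < CARD('n)"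
  obtains x :: "real ^ ('n \<Rightarrow> 'n)"
    where "\<And>P Q. range Q \<subseteq> B \<Longrightarrow> x \<bullet> coeff_vec P Q = 0"
      and "\<And>\<sigma>. \<not> evenperm \<sigma> \<Longrightarrow> x $ \<sigma> = (if \<sigma> = \<tau> then 1 else 0)"
proof -
  define W where "W = {coeff_vec P Q | (P :: 'n \<Rightarrow> 'a) Q. range Q \<subseteq> B}"
  obtain w z where w: "w \<in> span W" and z: "\<And>u. u \<in> span W \<Longrightarrow> orthogonal z u"
    and wz: "axis \<tau> (1 :: real) = w + z"
    using orthogonal_subspace_decomp_exists[of W "axis \<tau> (1 :: real)"] by metis
  \<comment> \<open>The generators of \<open>W\<close> have twists orthogonal to
    \<open>coeff_vec R S\<close>; linearity carries this over to \<open>w\<close>.\<close>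
  have tw: "sign_twist w \<bullet> coeff_vec R S = 0" if S: "range S \<subseteq> B" for R S :: "'n \<Rightarrow> 'a"
    using w
  proof (induction w rule: span_induct_alt)
    case base
    show ?case by (simp add: linear_0[OF linear_sign_twist])
  next
    case (step c u v)
    then show ?case
      using inner_sign_twist_coeff_vec[OF B _ S]
      by (auto simp: W_def linear_add[OF linear_sign_twist] linear_scale[OF linear_sign_twist]
          inner_add_left)
  qed
  show thesis
  proof
    show "(z - sign_twist w) \<bullet> coeff_vec P Q = 0" if "range Q \<subseteq> B" for P Q :: "'n \<Rightarrow> 'a"
      using z[OF span_base, of "coeff_vec P Q"] tw[of Q P] that
      by (auto simp: W_def orthogonal_def inner_diff_left)
    show "(z - sign_twist w) $ \<sigma> = (if \<sigma> = \<tau> then 1 else 0)" if "\<not> evenperm \<sigma>" for \<sigma>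
    proof -
      \<comment> \<open>The sign at \<sigma> is \<open>-1\<close>, so
        \<open>z - sign_twist w\<close> has the same entry there as \<open>w + z\<close>.\<close>
      have "w $ \<sigma> + z $ \<sigma> = axis \<tau> 1 $ \<sigma>"
        by (simp add: wz)
      then show ?thesis
        using that by (simp add: sign_twist_def sign_def axis_def eq_commute[of \<tau>])
    qed
  qed
qed

section \<open>Linear relations among permutation operators\<close>

text \<open>On the pure tensor of \<open>Q\<close>, the terms with the same image tuple
  \<open>P\<close> add up to \<open>x \<bullet> coeff_vec P Q\<close> times the pure tensor of
  \<open>P\<close>. It suffices to test tuples \<open>Q\<close> with entries in
  \<open>B\<close>.\<close>

lemma sum_tensor_perm_eq_0:
  fixes x :: "real ^ ('n::finite \<Rightarrow> 'n)" and t :: "('v::complex_vector, 'n) tensor_power"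
  assumes B: "complex_vector.span B = (UNIV :: 'v set)"
    and x: "\<And>P Q. range Q \<subseteq> B \<Longrightarrow> x \<bullet> coeff_vec P Q = 0"
  shows "(\<Sum>\<sigma>\<in>symmetric_group. complex_of_real (x $ \<sigma>) *\<^sub>C tensor_perm \<sigma> t) = 0"
proof -
  let ?f = "\<lambda>t :: ('v, 'n) tensor_power.
    \<Sum>\<sigma>\<in>symmetric_group. complex_of_real (x $ \<sigma>) *\<^sub>C tensor_perm \<sigma> t"
  have "clinear ?f"
  proof (rule clinearI)
    fix s t :: "('v, 'n) tensor_power" and c
    have linD: "tensor_perm \<sigma> (s + t) = tensor_perm \<sigma> s + tensor_perm \<sigma> t"
      "tensor_perm \<sigma> (c *\<^sub>C t) = c *\<^sub>C tensor_perm \<sigma> t" if "\<sigma> \<in> symmetric_group" for \<sigma>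
    proof -
      interpret Vector_Spaces.linear "(*\<^sub>C)" "(*\<^sub>C)"
          "tensor_perm \<sigma> :: ('v, 'n) tensor_power \<Rightarrow> ('v, 'n) tensor_power"
        using that by (simp add: symmetric_group_def clinear_tensor_perm)
      show "tensor_perm \<sigma> (s + t) = tensor_perm \<sigma> s + tensor_perm \<sigma> t"
        "tensor_perm \<sigma> (c *\<^sub>C t) = c *\<^sub>C tensor_perm \<sigma> t"
        by (rule add scale)+
    qed
    show "?f (s + t) = ?f s + ?f t"
      unfolding sum.distrib[symmetric]
      by (rule sum.cong) (simp_all add: linD scaleC_add_right)
    show "?f (c *\<^sub>C t) = c *\<^sub>C ?f t"
      unfolding complex_vector.scale_sum_right
      by (rule sum.cong) (simp_all add: linD scaleC_scaleC mult.commute)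
  qed
  moreover have "?f (pure_tensor Q) = 0" if Q: "range Q \<subseteq> B" for Q
  proof -
    define F where "F = (\<lambda>\<sigma> :: 'n \<Rightarrow> 'n. Q \<circ> inv \<sigma>)"
    have "F \<sigma> = P \<longleftrightarrow> P \<circ> \<sigma> = Q" if "\<sigma> permutes UNIV" for \<sigma> P
      unfolding F_def using permutes_inv_o[OF that] by (metis comp_assoc comp_id)
    then have fibre: "{\<sigma>. \<sigma> permutes UNIV \<and> P \<circ> \<sigma> = Q} = {\<sigma> \<in> symmetric_group. F \<sigma> = P}" for P
      by (auto simp: symmetric_group_def)
    have "?f (pure_tensor Q)
        = (\<Sum>\<sigma>\<in>symmetric_group. complex_of_real (x $ \<sigma>) *\<^sub>C pure_tensor (F \<sigma>))"
      by (rule sum.cong) (auto simp: symmetric_group_def tensor_perm_pure F_def)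
    also have "\<dots> = (\<Sum>P\<in>F ` symmetric_group. \<Sum>\<sigma> | \<sigma> \<in> symmetric_group \<and> F \<sigma> = P.
        complex_of_real (x $ \<sigma>) *\<^sub>C pure_tensor (F \<sigma>))"
      by (rule sum.image_gen) simp
    also have "\<dots> = (\<Sum>P\<in>F ` symmetric_group. complex_of_real (x \<bullet> coeff_vec P Q) *\<^sub>C pure_tensor P)"
      unfolding inner_coeff_vec fibre of_real_sum complex_vector.scale_sum_left
      by (intro sum.cong refl) auto
    also have "\<dots> = 0"
      by (simp add: x[OF Q])
    finally show ?thesis .
  qed
  ultimately show ?thesis
    using clinear_eq_0_if_eq_0_on_spanning_tensors[of ?f B t] B by simp
qed

text \<open>An odd \<tau> is the only odd permutation in a vanishing combination, which can be
  solved for its operator.\<close>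

lemma tensor_perm_eq_sum_alternating:
  fixes \<tau> :: "'n::finite \<Rightarrow> 'n"
  assumes B: "finite B" "complex_vector.span B = (UNIV :: 'v::complex_vector set)"
      "(card B)\<^sup>2 < CARD('n)"
    and \<tau>: "\<tau> \<in> symmetric_group"
  shows "\<exists>c. \<forall>t :: ('v, 'n) tensor_power.
    tensor_perm \<tau> t = (\<Sum>\<sigma>\<in>alternating_group. c \<sigma> *\<^sub>C tensor_perm \<sigma> t)"
proof (cases "evenperm \<tau>")
  case True
  then have "\<tau> \<in> alternating_group"
    using \<tau> by (simp add: alternating_group_def symmetric_group_def)
  then show ?thesis
    by (intro exI[of _ "\<lambda>\<sigma>. if \<sigma> = \<tau> then 1 else 0"])
      (simp add: if_distrib[of "\<lambda>c. c *\<^sub>C _"] scaleC_one sum.delta cong: if_cong)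
next
  case False
  obtain x :: "real ^ ('n \<Rightarrow> 'n)" where x: "\<And>P Q. range Q \<subseteq> B \<Longrightarrow> x \<bullet> coeff_vec P Q = 0"
    and odd: "\<And>\<sigma>. \<not> evenperm \<sigma> \<Longrightarrow> x $ \<sigma> = (if \<sigma> = \<tau> then 1 else 0)"
    using obtain_coeff_orthogonal_with_odd_part[OF B(1,3)] by metis
  show ?thesis
  proof (intro exI allI)
    fix t :: "('v, 'n) tensor_power"
    let ?f = "\<lambda>\<sigma>. complex_of_real (x $ \<sigma>) *\<^sub>C tensor_perm \<sigma> t"
    have \<tau>': "\<tau> \<in> symmetric_group - alternating_group"
      using \<tau> False by (simp add: alternating_group_def)
    have "0 = sum ?f symmetric_group"
      using sum_tensor_perm_eq_0[OF B(2) x] by simp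
    also have "\<dots> = sum ?f (symmetric_group - alternating_group) + sum ?f alternating_group"
      by (rule sum.subset_diff) (auto simp: alternating_group_def symmetric_group_def)
    \<comment> \<open>Every odd permutation other than \<tau> has coefficient zero.\<close>
    also have "sum ?f (symmetric_group - alternating_group) = sum ?f {\<tau>}"
      by (rule sum.mono_neutral_right)
        (use \<tau>' in \<open>auto simp: odd alternating_group_def symmetric_group_def\<close>)
    also have "\<dots> = tensor_perm \<tau> t"
      by (simp add: odd False scaleC_one)
    finally show "tensor_perm \<tau> t
        = (\<Sum>\<sigma>\<in>alternating_group. (- complex_of_real (x $ \<sigma>)) *\<^sub>C tensor_perm \<sigma> t)"
      by (simp add: sum_negf add_eq_0_iff2)
  qed
qed

section \<open>Group algebra images and commutants\<close>

lemma tensor_rep_eq_sum: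
  assumes "a \<in> group_algebra G"
  shows "tensor_rep a t = (\<Sum>\<sigma>\<in>G. Poly_Mapping.lookup a \<sigma> *\<^sub>C tensor_perm \<sigma> t)"
  unfolding tensor_rep_def
  by (rule sum.mono_neutral_left) (use assms in \<open>auto simp: group_algebra_def in_keys_iff\<close>)

text \<open>The index type has only finitely many self-maps, so any coefficient family cut off
  outside \<open>G\<close> is finitely supported and defines an element of the group
  algebra.\<close>

lemma sum_tensor_perm_in_tensor_rep:
  "(\<lambda>t. \<Sum>\<sigma>\<in>G. c \<sigma> *\<^sub>C tensor_perm \<sigma> t) \<in> tensor_rep ` group_algebra G"
proof
  let ?a = "Abs_poly_mapping (\<lambda>\<sigma>. if \<sigma> \<in> G then c \<sigma> else 0)"
  have lookup: "Poly_Mapping.lookup ?a = (\<lambda>\<sigma>. if \<sigma> \<in> G then c \<sigma> else 0)"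
    by (simp add: Abs_poly_mapping_inverse)
  show mem: "?a \<in> group_algebra G"
    by (auto simp: group_algebra_def in_keys_iff lookup split: if_splits)
  show "(\<lambda>t. \<Sum>\<sigma>\<in>G. c \<sigma> *\<^sub>C tensor_perm \<sigma> t) = tensor_rep ?a"
    by (rule ext) (simp add: tensor_rep_eq_sum[OF mem] lookup)
qed

theorem theorem1:
  fixes k :: nat
  assumes fin_dim: "\<exists>B :: 'v::complex_vector set. finite B \<and> complex_vector.span B = UNIV"
    and dim: "complex_vector.dim (UNIV :: 'v set) = k"
    and k_n: "k\<^sup>2 < CARD('n)"
  shows "(tensor_rep ` group_algebra alternating_group
            :: (('v, 'n::finite) tensor_power \<Rightarrow> ('v, 'n) tensor_power) set)
           = tensor_rep ` group_algebra symmetric_group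
       \<and> (commuting_End alternating_group
            :: (('v, 'n) tensor_power \<Rightarrow> ('v, 'n) tensor_power) set)
           = commuting_End symmetric_group"
proof -
  obtain B0 :: "'v set" where B0: "finite B0" "complex_vector.span B0 = UNIV"
    using fin_dim by blast
  \<comment> \<open>A maximal independent subset of \<open>B0\<close> still spans and, being a
    basis, has exactly \<open>k\<close> elements.\<close>
  obtain B where B: "B \<subseteq> B0" "complex_vector.independent B" "B0 \<subseteq> complex_vector.span B"
    using complex_vector.maximal_independent_subset by blast
  have fin: "finite B" using B(1) B0(1) by (rule finite_subset)
  have span: "complex_vector.span B = UNIV"
    using complex_vector.span_minimal[OF B(3) complex_vector.subspace_span] B0(2) by auto
  have "card B = k"
    using complex_vector.dim_eq_card[of B UNIV] B(2) span dim by simp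
  then have "\<forall>\<tau>\<in>symmetric_group. \<exists>c. \<forall>t :: ('v, 'n) tensor_power.
      tensor_perm \<tau> t = (\<Sum>\<sigma>\<in>alternating_group. c \<sigma> *\<^sub>C tensor_perm \<sigma> t)"
    using tensor_perm_eq_sum_alternating[OF fin span] k_n by blast
  then obtain c where c: "\<And>\<tau> t. \<tau> \<in> symmetric_group \<Longrightarrow>
      tensor_perm \<tau> (t :: ('v, 'n) tensor_power)
        = (\<Sum>\<sigma>\<in>alternating_group. c \<tau> \<sigma> *\<^sub>C tensor_perm \<sigma> t)"
    by metis
  have sub: "alternating_group \<subseteq> (symmetric_group :: ('n \<Rightarrow> 'n) set)"
    by (auto simp: alternating_group_def symmetric_group_def)
  have "tensor_rep a \<in> (tensor_rep ` group_algebra alternating_group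
      :: (('v, 'n) tensor_power \<Rightarrow> ('v, 'n) tensor_power) set)"
    if a: "a \<in> group_algebra symmetric_group" for a
  proof -
    \<comment> \<open>Substituting the expansion of each \<tau> and exchanging the sums collects the
      coefficient of each even \<sigma>.\<close>
    have "tensor_rep a = (\<lambda>t :: ('v, 'n) tensor_power. \<Sum>\<sigma>\<in>alternating_group.
        (\<Sum>\<tau>\<in>symmetric_group. Poly_Mapping.lookup a \<tau> * c \<tau> \<sigma>) *\<^sub>C tensor_perm \<sigma> t)"
    proof
      fix t :: "('v, 'n) tensor_power"
      have "tensor_rep a t = (\<Sum>\<tau>\<in>symmetric_group. \<Sum>\<sigma>\<in>alternating_group.
          (Poly_Mapping.lookup a \<tau> * c \<tau> \<sigma>) *\<^sub>C tensor_perm \<sigma> t)"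
        unfolding tensor_rep_eq_sum[OF a]
        by (rule sum.cong) (simp_all add: c complex_vector.scale_sum_right scaleC_scaleC)
      also have "\<dots> = (\<Sum>\<sigma>\<in>alternating_group.
          (\<Sum>\<tau>\<in>symmetric_group. Poly_Mapping.lookup a \<tau> * c \<tau> \<sigma>) *\<^sub>C tensor_perm \<sigma> t)"
        unfolding complex_vector.scale_sum_left by (rule sum.swap)
      finally show "tensor_rep a t = \<dots>" .
    qed
    then show ?thesis
      by (simp only: sum_tensor_perm_in_tensor_rep)
  qed
  moreover have "group_algebra alternating_group \<subseteq> group_algebra (symmetric_group :: ('n \<Rightarrow> 'n) set)"
    using sub by (auto simp: group_algebra_def)
  moreover have "f \<in> commuting_End symmetric_group" if f: "f \<in> commuting_End alternating_group"
    for f :: "('v, 'n) tensor_power \<Rightarrow> ('v, 'n) tensor_power"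
  proof -
    have lin: "clinear f" and comm: "\<And>\<sigma> t. \<sigma> \<in> alternating_group \<Longrightarrow>
        f (tensor_perm \<sigma> t) = tensor_perm \<sigma> (f t)"
      using f by (auto simp: commuting_End_def fun_eq_iff)
    interpret f: Vector_Spaces.linear "(*\<^sub>C)" "(*\<^sub>C)" f by fact
    \<comment> \<open>A linear map commuting with the even operators commutes with their linear
      combinations, hence with every permutation operator.\<close>
    show ?thesis
      by (auto simp: commuting_End_def fun_eq_iff lin c f.sum f.scale comm)
  qed
  moreover have "commuting_End symmetric_group \<subseteq>
      (commuting_End alternating_group :: (('v, 'n) tensor_power \<Rightarrow> _) set)"
    using sub by (auto simp: commuting_End_def)
  ultimately show ?thesis by blast
qed

end
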